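(* Let $G$ be a group, let $k\in\mathbb{N}$, and let $T:G\to\mathcal{B}(\mathbb{C}^k)$ be a positive definite function such that $\{T(s):s\in G\}$ is a family of commuting $k\times k$ matrices. Then for every $n\in\mathbb{N}$ the map $T_n:G\to\mathcal{B}(\mathbb{C}^k)$, $T_n(s)=T(s)^n$, is a positive definite function.
   Context: For a group $G$ and a complex Hilbert space $\mathcal{H}$, a map $T:G\to\mathcal{B}(\mathcal{H})$ (bounded linear operators) is positive definite if $T(s^{-1})=T(s)^*$ for every $s\in G$ and $\sum_{s\in G}\sum_{t\in G}\langle T(t^{-1}s)h(s),h(t)\rangle\ge 0$ for every finitely supported function $h:G\to\mathcal{H}$. *)

theory Defs
  imports "HOL-Algebra.Group" "Jordan_Normal_Form.Schur_Decomposition"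
begin

(* B(C^k) is represented by the complex k x k matrices acting on C^k = carrier_vec k. The inner
   product v \<bullet>c w = (\<Sum>i. v_i * cnj w_i) is linear in the first argument, and mat_adjoint is the
   conjugate transpose. The order on complex is that of HOL-Library.Complex_Order:
   0 \<le> z means that z is real and nonnegative. *)

definition supp_on :: "('a, 'b) monoid_scheme \<Rightarrow> nat \<Rightarrow> ('a \<Rightarrow> complex vec) \<Rightarrow> 'a set" where
  "supp_on G k h = {s \<in> carrier G. h s \<noteq> 0\<^sub>v k}"

(* The terms of the double sum vanish unless both s and t lie in the support of h, so the
   sums over G are sums over that finite set. *)
definition positive_definite ::
    "('a, 'b) monoid_scheme \<Rightarrow> nat \<Rightarrow> ('a \<Rightarrow> complex mat) \<Rightarrow> bool" where
  "positive_definite G k T \<longleftrightarrow>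
     T \<in> carrier G \<rightarrow> carrier_mat k k \<and>
     (\<forall>s \<in> carrier G. T (inv\<^bsub>G\<^esub> s) = mat_adjoint (T s)) \<and>
     (\<forall>h \<in> carrier G \<rightarrow> carrier_vec k. finite (supp_on G k h) \<longrightarrow>
        0 \<le> (\<Sum>s \<in> supp_on G k h. \<Sum>t \<in> supp_on G k h.
               (T (inv\<^bsub>G\<^esub> t \<otimes>\<^bsub>G\<^esub> s) *\<^sub>v h s) \<bullet>c h t))"

end

theory Submission
  imports Defs
begin

text \<open>
  For a fixed finitely supported \<open>h\<close> only the finitely many matrices \<open>T(t\<inverse>s)\<close> with \<open>s, t\<close> in the
  support matter. They commute and are closed under adjoints, so they have a common orthogonal
  eigenbasis \<open>X\<close>. By Parseval's identity the form of \<open>T\<^sup>n\<close> at \<open>h\<close> is a sum over \<open>x \<in> X\<close> of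
  forms of the scalar kernels \<open>d\<^sub>x(s,t)\<^sup>n\<close>, where \<open>d\<^sub>x(s,t)\<close> is the eigenvalue at \<open>x\<close>.
  Positive definiteness of \<open>T\<close> on functions with values in the line through \<open>x\<close> says that \<open>d\<^sub>x\<close>
  is positive semidefinite, and so are its powers by the Schur product theorem.
\<close>

section \<open>Schur products of positive semidefinite kernels\<close>

text \<open>Matrices indexed by an arbitrary set rather than by numbers: finite subsets of the group
  then serve as index sets directly, and the Schur product theorem can be proved by inserting one
  index at a time.\<close>

definition psd_kernel :: "'i set \<Rightarrow> ('i \<Rightarrow> 'i \<Rightarrow> complex) \<Rightarrow> bool" where
  "psd_kernel S K \<longleftrightarrow>
     (\<forall>s\<in>S. \<forall>t\<in>S. K s t = cnj (K t s)) \<and>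
     (\<forall>c. 0 \<le> (\<Sum>s\<in>S. \<Sum>t\<in>S. K s t * (c s * cnj (c t))))"

lemma mult_cnj_nonneg: "0 \<le> z * cnj z"
  by (simp add: less_eq_complex_def)

lemma complex_divide_1_nonneg: "0 \<le> (z :: complex) \<Longrightarrow> 0 \<le> 1 / z"
  by (auto simp: less_eq_complex_def Re_divide Im_divide)

lemma complex_power_nonneg:
  assumes "0 \<le> (z :: complex)"
  shows "0 \<le> z ^ n"
proof (induction n)
  case (Suc n)
  then show ?case using assms unfolding power_Suc by (intro mult_nonneg_nonneg)
qed (simp add: less_eq_complex_def)

lemma psd_kernel_hermitian:
  "psd_kernel S K \<Longrightarrow> s \<in> S \<Longrightarrow> t \<in> S \<Longrightarrow> cnj (K t s) = K s t"
  unfolding psd_kernel_def by metis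

lemma psd_kernel_form: "psd_kernel S K \<Longrightarrow> 0 \<le> (\<Sum>s\<in>S. \<Sum>t\<in>S. K s t * (c s * cnj (c t)))"
  unfolding psd_kernel_def by blast

text \<open>Coefficients on \<open>R\<close> are extended by zero to \<open>S\<close>, which leaves
  the value of the form unchanged.\<close>

lemma psd_kernel_subset:
  fixes S :: "'a set"
  assumes "finite S" "R \<subseteq> S" "psd_kernel S K"
  shows "psd_kernel R K"
  unfolding psd_kernel_def
proof (intro conjI ballI allI)
  fix s t assume "s \<in> R" "t \<in> R"
  then show "K s t = cnj (K t s)"
    using assms psd_kernel_hermitian by (metis subsetD)
next
  fix c :: "'a \<Rightarrow> complex"
  define c' where "c' = (\<lambda>s. if s \<in> R then c s else 0)"
  have "(\<Sum>s\<in>S. \<Sum>t\<in>S. K s t * (c' s * cnj (c' t))) = (\<Sum>s\<in>R. \<Sum>t\<in>S. K s t * (c' s * cnj (c' t)))"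
    using assms by (intro sum.mono_neutral_right) (auto simp: c'_def)
  also have "\<dots> = (\<Sum>s\<in>R. \<Sum>t\<in>R. K s t * (c s * cnj (c t)))"
  proof (rule sum.cong[OF refl])
    fix s assume "s \<in> R"
    have "(\<Sum>t\<in>S. K s t * (c' s * cnj (c' t))) = (\<Sum>t\<in>R. K s t * (c' s * cnj (c' t)))"
      using assms by (intro sum.mono_neutral_right) (auto simp: c'_def)
    then show "(\<Sum>t\<in>S. K s t * (c' s * cnj (c' t))) = (\<Sum>t\<in>R. K s t * (c s * cnj (c t)))"
      using \<open>s \<in> R\<close> by (simp add: c'_def)
  qed
  finally show "0 \<le> (\<Sum>s\<in>R. \<Sum>t\<in>R. K s t * (c s * cnj (c t)))"
    using psd_kernel_form[OF assms(3), of c'] by simp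
qed

lemma psd_kernel_diag_nonneg:
  assumes "finite S" "psd_kernel S K" "a \<in> S"
  shows "0 \<le> K a a"
  using psd_kernel_form[OF psd_kernel_subset[OF assms(1) _ assms(2), of "{a}"], of "\<lambda>_. 1"] assms(3)
  by simp

text \<open>On the index pair \<open>{a, s}\<close> a vanishing diagonal entry at \<open>a\<close>
  leaves no quadratic term in the coefficient at \<open>a\<close>. A nonzero off-diagonal entry
  would then contribute an unbounded linear term and make the form negative.\<close>

lemma psd_kernel_zero_diag:
  assumes "finite S" "psd_kernel S K" "a \<in> S" "s \<in> S" "K a a = 0"
  shows "K s a = 0"
proof (rule ccontr)
  assume ne: "K s a \<noteq> 0"
  then have "s \<noteq> a" using assms(5) by auto
  define w where "w = K s a"
  have w: "K s a = w" "K a s = cnj w"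
    using psd_kernel_hermitian[OF assms(2) assms(3,4)] by (auto simp: w_def)
  define r where "r = Re (K s s)"
  have kr: "K s s = of_real r" "0 \<le> r"
    using psd_kernel_diag_nonneg[OF assms(1,2,4)]
    by (auto simp: r_def less_eq_complex_def complex_eq_iff)
  \<comment> \<open>With the coefficients \<open>c\<close> below the form equals
    \<open>r - 2 * m * |w|^2\<close>; this \<open>m\<close> turns it into \<open>- r - 2\<close>,
    which is negative.\<close>
  define m where "m = (r + 1) / (cmod w)\<^sup>2"
  define c where "c = (\<lambda>t. if t = a then - of_real m * w else 1 :: complex)"
  have mw: "m * (cmod w)\<^sup>2 = r + 1"
    using ne by (simp add: m_def w_def)
  have ww: "w * cnj w = of_real ((cmod w)\<^sup>2)"
    by (rule complex_norm_square[symmetric])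
  have "(\<Sum>x\<in>{a,s}. \<Sum>y\<in>{a,s}. K x y * (c x * cnj (c y)))
      = of_real r - 2 * of_real m * (w * cnj w)"
    using \<open>s \<noteq> a\<close> by (simp add: c_def w kr assms(5) algebra_simps)
  also have "\<dots> = of_real (r - 2 * (m * (cmod w)\<^sup>2))"
    by (simp add: ww)
  finally have "0 \<le> (of_real (r - 2 * (m * (cmod w)\<^sup>2)) :: complex)"
    using psd_kernel_form[OF psd_kernel_subset[OF assms(1) _ assms(2), of "{a,s}"], of c] assms(3,4)
    by simp
  then show False
    using mw kr(2) by (simp add: less_eq_complex_def)
qed

text \<open>The Schur complement of the diagonal entry at \<open>a\<close>; if that entry vanishes, then so does
  its whole row, and \<open>x / 0 = 0\<close> makes the formula still correct.\<close>
lemma psd_kernel_schur_complement: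
  assumes "finite S" "a \<notin> S" "psd_kernel (insert a S) K"
  shows "psd_kernel S (\<lambda>s t. K s t - K s a * K a t / K a a)"
proof -
  have herm: "cnj (K t s) = K s t" if "s \<in> insert a S" "t \<in> insert a S" for s t
    using psd_kernel_hermitian[OF assms(3) that] .
  have form: "0 \<le> (\<Sum>s\<in>S. \<Sum>t\<in>S. (K s t - K s a * K a t / K a a) * (c s * cnj (c t)))" for c
  proof -
    define b where "b = (\<Sum>s\<in>S. K s a * c s)"
    \<comment> \<open>Completing the square: for \<open>K a a\<close> positive this coefficient at
      \<open>a\<close> minimises the form for given coefficients on \<open>S\<close>, and the
      minimum is the form of the Schur complement. For \<open>K a a = 0\<close> it is
      \<open>0\<close>.\<close>
    define z where "z = - (b / K a a)"
    define c' where "c' = c(a := z)"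
    have cz: "cnj z = - (cnj b / K a a)"
      by (simp add: z_def herm)
    have c': "c' s = c s" if "s \<in> S" for s
      using that assms(2) by (auto simp: c'_def)
    have cb: "(\<Sum>t\<in>S. K a t * cnj (c t)) = cnj b"
      by (auto simp: b_def herm intro!: sum.cong)
    have "(\<Sum>s\<in>insert a S. \<Sum>t\<in>insert a S. K s t * (c' s * cnj (c' t)))
       = K a a * (z * cnj z) + (\<Sum>t\<in>S. K a t * (z * cnj (c t)))
         + (\<Sum>s\<in>S. K s a * (c s * cnj z)) + (\<Sum>s\<in>S. \<Sum>t\<in>S. K s t * (c s * cnj (c t)))"
      using assms(1,2) by (simp add: sum.distrib c' c'_def[THEN fun_cong, of a])
    also have "(\<Sum>t\<in>S. K a t * (z * cnj (c t))) = z * cnj b"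
      unfolding cb[symmetric] sum_distrib_left by (simp add: mult_ac)
    also have "(\<Sum>s\<in>S. K s a * (c s * cnj z)) = b * cnj z"
      unfolding b_def sum_distrib_right by (simp add: mult_ac)
    also have "K a a * (z * cnj z) + z * cnj b + b * cnj z = - (b * cnj b / K a a)"
      unfolding cz z_def by (cases "K a a = 0") (simp_all add: field_simps)
    also have "b * cnj b = (\<Sum>s\<in>S. \<Sum>t\<in>S. (K s a * c s) * (K a t * cnj (c t)))"
      unfolding cb[symmetric] unfolding b_def sum_product ..
    finally have "(\<Sum>s\<in>insert a S. \<Sum>t\<in>insert a S. K s t * (c' s * cnj (c' t)))
       = (\<Sum>s\<in>S. \<Sum>t\<in>S. (K s t - K s a * K a t / K a a) * (c s * cnj (c t)))"
      by (simp add: sum_divide_distrib sum_subtractf[symmetric] right_diff_distrib mult_ac)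
    then show ?thesis
      using psd_kernel_form[OF assms(3), of c'] by simp
  qed
  show ?thesis
    unfolding psd_kernel_def using form by (auto simp: herm mult.commute)
qed

text \<open>Splitting off the Schur complement leaves the rank one kernel \<open>K s a * cnj (K t a) / K a a\<close>,
  whose product with \<open>L\<close> is visibly positive semidefinite.\<close>
lemma psd_kernel_mult:
  assumes "finite S" "psd_kernel S K" "psd_kernel S L"
  shows "psd_kernel S (\<lambda>s t. K s t * L s t)"
  using assms
proof (induction S arbitrary: K rule: finite_induct)
  case empty
  then show ?case by (simp add: psd_kernel_def)
next
  case (insert a S)
  let ?S = "insert a S"
  have fin: "finite ?S" using insert.hyps by simp
  define K' where "K' = (\<lambda>s t. K s t - K s a * K a t / K a a)"
  have herm: "cnj (K t s) = K s t" if "s \<in> ?S" "t \<in> ?S" for s t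
    using psd_kernel_hermitian[OF insert.prems(1) that] .
  have zero: "K s a = 0 \<and> K a s = 0" if "K a a = 0" "s \<in> ?S" for s
    using psd_kernel_zero_diag[OF fin insert.prems(1) _ that(2,1)] herm[of a s] that by auto
  \<comment> \<open>The row and the column of \<open>a\<close> vanish in \<open>K'\<close>, so its
    product with \<open>L\<close> lives on \<open>S\<close>, where the induction hypothesis
    applies.\<close>
  have K'a: "K' s a = 0" "K' a s = 0" if "s \<in> ?S" for s
    using zero[OF _ that] by (cases "K a a = 0"; simp add: K'_def)+
  have "psd_kernel S K'"
    unfolding K'_def by (rule psd_kernel_schur_complement[OF insert.hyps insert.prems(1)])
  moreover have "psd_kernel S L"
    using psd_kernel_subset[OF fin _ insert.prems(2)] by blast
  ultimately have IH: "psd_kernel S (\<lambda>s t. K' s t * L s t)"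
    by (rule insert.IH)
  have "0 \<le> (\<Sum>s\<in>?S. \<Sum>t\<in>?S. K s t * L s t * (c s * cnj (c t)))" for c
  proof -
    \<comment> \<open>Since \<open>K a t = cnj (K t a)\<close>, the rank one part can be absorbed
      into the coefficients: it contributes the form of \<open>L\<close> at
      \<open>K s a * c s\<close>, scaled by \<open>1 / K a a\<close>.\<close>
    have split: "K s t * L s t * (c s * cnj (c t)) = K' s t * L s t * (c s * cnj (c t))
        + 1 / K a a * (L s t * ((K s a * c s) * cnj (K t a * c t)))" if "s \<in> ?S" "t \<in> ?S" for s t
      using that by (simp add: K'_def herm algebra_simps)
    have "(\<Sum>s\<in>?S. \<Sum>t\<in>?S. K s t * L s t * (c s * cnj (c t)))
      = (\<Sum>s\<in>?S. \<Sum>t\<in>?S. K' s t * L s t * (c s * cnj (c t)))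
        + 1 / K a a * (\<Sum>s\<in>?S. \<Sum>t\<in>?S. L s t * ((K s a * c s) * cnj (K t a * c t)))"
      unfolding sum_distrib_left sum.distrib[symmetric] using split
      by (intro sum.cong refl) blast
    moreover have "(\<Sum>s\<in>?S. \<Sum>t\<in>?S. K' s t * L s t * (c s * cnj (c t)))
      = (\<Sum>s\<in>S. \<Sum>t\<in>S. K' s t * L s t * (c s * cnj (c t)))"
      using insert.hyps by (simp add: K'a)
    moreover have "0 \<le> 1 / K a a"
      using psd_kernel_diag_nonneg[OF fin insert.prems(1), of a]
      by (simp add: complex_divide_1_nonneg)
    ultimately show ?thesis
      using psd_kernel_form[OF IH, of c] psd_kernel_form[OF insert.prems(2), of "\<lambda>s. K s a * c s"]
      by (metis (no_types, lifting) add_nonneg_nonneg mult_nonneg_nonneg)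
  qed
  then show ?case
    unfolding psd_kernel_def using herm psd_kernel_hermitian[OF insert.prems(2)] by auto
qed

text \<open>Iterated Schur products. The induction starts from the kernel that is constantly
  \<open>1\<close>, also where \<open>K\<close> vanishes, and its form is the squared modulus of the
  sum of the coefficients.\<close>

lemma psd_kernel_power:
  assumes "finite S" "psd_kernel S K"
  shows "psd_kernel S (\<lambda>s t. K s t ^ n)"
proof (induction n)
  case 0
  have "(\<Sum>s\<in>S. \<Sum>t\<in>S. c s * cnj (c t)) = (\<Sum>s\<in>S. c s) * cnj (\<Sum>s\<in>S. c s)" for c
    by (simp add: sum_product)
  then show ?case
    using mult_cnj_nonneg[of "\<Sum>s\<in>S. c s" for c] by (simp add: psd_kernel_def del: cnj_sum)
next
  case (Suc n)
  then show ?case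
    using psd_kernel_mult[OF assms Suc] by simp
qed

section \<open>The adjoint and the inner product\<close>

lemma cprod_sum:
  fixes u v :: "complex vec"
  assumes "v \<in> carrier_vec k"
  shows "u \<bullet>c v = (\<Sum>i<k. u $ i * cnj (v $ i))"
  using assms by (auto simp: scalar_prod_def lessThan_atLeast0 intro!: sum.cong)

lemma cprod_commute:
  fixes u v :: "complex vec"
  assumes "u \<in> carrier_vec k" "v \<in> carrier_vec k"
  shows "cnj (u \<bullet>c v) = v \<bullet>c u"
  using assms by (simp add: cprod_sum[of _ k] mult.commute)

lemma cprod_smult_right:
  fixes u v :: "complex vec"
  assumes "u \<in> carrier_vec k" "v \<in> carrier_vec k"
  shows "u \<bullet>c (c \<cdot>\<^sub>v v) = cnj c * (u \<bullet>c v)"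
proof -
  have "u \<bullet>c (c \<cdot>\<^sub>v v) = (\<Sum>i<k. cnj c * (u $ i * cnj (v $ i)))"
    using assms by (subst cprod_sum[of _ k]) (auto simp: mult_ac)
  then show ?thesis
    using assms by (simp only: cprod_sum[of v k] sum_distrib_left)
qed

lemma mat_adjoint_carrier:
  "A \<in> carrier_mat k k \<Longrightarrow> mat_adjoint A \<in> carrier_mat k k"
  unfolding mat_adjoint_def by (intro carrier_matI) simp_all

lemma index_mat_adjoint:
  fixes A :: "complex mat"
  assumes "A \<in> carrier_mat k k" "i < k" "j < k"
  shows "mat_adjoint A $$ (i, j) = cnj (A $$ (j, i))"
  using assms unfolding mat_adjoint_def by (simp add: mat_of_rows_index)

lemma mat_adjoint_mult:
  fixes A B :: "complex mat"
  assumes "A \<in> carrier_mat k k" "B \<in> carrier_mat k k"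
  shows "mat_adjoint (A * B) = mat_adjoint B * mat_adjoint A"
proof (rule eq_matI)
  have c: "mat_adjoint (A * B) \<in> carrier_mat k k" "mat_adjoint A \<in> carrier_mat k k"
    "mat_adjoint B \<in> carrier_mat k k"
    using assms by (auto intro!: mat_adjoint_carrier)
  then show "dim_row (mat_adjoint (A * B)) = dim_row (mat_adjoint B * mat_adjoint A)"
    "dim_col (mat_adjoint (A * B)) = dim_col (mat_adjoint B * mat_adjoint A)"
    by auto
  fix i j assume "i < dim_row (mat_adjoint B * mat_adjoint A)" "j < dim_col (mat_adjoint B * mat_adjoint A)"
  with c have "i < k" "j < k" by auto
  then show "mat_adjoint (A * B) $$ (i, j) = (mat_adjoint B * mat_adjoint A) $$ (i, j)"
    using assms c
    by (simp add: index_mat_adjoint[of "A * B" k] scalar_prod_def index_mat_adjoint[of _ k] mult.commute)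
qed

lemma mat_adjoint_one: "mat_adjoint (1\<^sub>m k :: complex mat) = 1\<^sub>m k"
proof (rule eq_matI)
  have c: "mat_adjoint (1\<^sub>m k :: complex mat) \<in> carrier_mat k k"
    by (auto intro!: mat_adjoint_carrier)
  then show "dim_row (mat_adjoint (1\<^sub>m k :: complex mat)) = dim_row (1\<^sub>m k)"
    "dim_col (mat_adjoint (1\<^sub>m k :: complex mat)) = dim_col (1\<^sub>m k)" by auto
qed (auto simp: index_mat_adjoint[of _ k])

text \<open>\<open>^\<^sub>m\<close> recurses by multiplication on the right, whereas taking
  adjoints reverses products and so produces the factor on the left.\<close>

lemma pow_mat_Suc_left:
  assumes "A \<in> carrier_mat k k"
  shows "A ^\<^sub>m Suc n = A * A ^\<^sub>m n"
  using assms by (induction n) (auto simp: assoc_mult_mat[of _ k k _ k _ k])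

lemma mat_adjoint_pow:
  fixes A :: "complex mat"
  assumes "A \<in> carrier_mat k k"
  shows "mat_adjoint (A ^\<^sub>m n) = mat_adjoint A ^\<^sub>m n"
proof (induction n)
  case 0
  then show ?case using assms mat_adjoint_carrier[OF assms] by (auto simp: mat_adjoint_one)
next
  case (Suc n)
  have "mat_adjoint (A ^\<^sub>m Suc n) = mat_adjoint A * mat_adjoint (A ^\<^sub>m n)"
    using assms by (simp add: mat_adjoint_mult[of _ k])
  then show ?case
    using Suc pow_mat_Suc_left[OF mat_adjoint_carrier[OF assms]] by simp
qed

lemma cprod_mat_adjoint:
  fixes A :: "complex mat"
  assumes "A \<in> carrier_mat k k" "u \<in> carrier_vec k" "v \<in> carrier_vec k"
  shows "(A *\<^sub>v u) \<bullet>c v = u \<bullet>c (mat_adjoint A *\<^sub>v v)"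
proof -
  have c: "mat_adjoint A \<in> carrier_mat k k" by (rule mat_adjoint_carrier[OF assms(1)])
  have "(A *\<^sub>v u) \<bullet>c v = (\<Sum>i<k. \<Sum>j<k. A $$ (i, j) * u $ j * cnj (v $ i))"
    using assms
    by (auto simp: cprod_sum[of v k] scalar_prod_def sum_distrib_right lessThan_atLeast0 intro!: sum.cong)
  also have "\<dots> = (\<Sum>j<k. \<Sum>i<k. A $$ (i, j) * u $ j * cnj (v $ i))"
    by (rule sum.swap)
  also have "\<dots> = (\<Sum>j<k. u $ j * cnj ((mat_adjoint A *\<^sub>v v) $ j))"
  proof (rule sum.cong[OF refl])
    fix j assume "j \<in> {..<k}"
    then have "(mat_adjoint A *\<^sub>v v) $ j = (\<Sum>i<k. cnj (A $$ (i, j)) * v $ i)"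
      using assms c
      by (auto simp: scalar_prod_def index_mat_adjoint[of _ k] lessThan_atLeast0 intro!: sum.cong)
    then show "(\<Sum>i<k. A $$ (i, j) * u $ j * cnj (v $ i)) = u $ j * cnj ((mat_adjoint A *\<^sub>v v) $ j)"
      by (simp add: sum_distrib_left mult_ac)
  qed
  also have "\<dots> = u \<bullet>c (mat_adjoint A *\<^sub>v v)"
    using assms c by (subst cprod_sum[of _ k]) auto
  finally show ?thesis .
qed

section \<open>Common eigenvectors\<close>

text \<open>Conjugated to upper triangular form, \<open>A - d I\<close> with \<open>d\<close> the diagonal entry at \<open>j\<close> sends
  vectors supported on the first \<open>j + 1\<close> coordinates to vectors supported on the first \<open>j\<close>.
  Descending in \<open>j\<close> from any nonzero vector, the last vector before \<open>0\<close> is an eigenvector.\<close>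
lemma eigenvector_in_invariant_set:
  fixes A :: "complex mat"
  assumes A: "A \<in> carrier_mat k k"
    and W: "W \<subseteq> carrier_vec k"
    and inv: "\<And>w c. w \<in> W \<Longrightarrow> A *\<^sub>v w - c \<cdot>\<^sub>v w \<in> W"
    and w: "w \<in> W" "w \<noteq> 0\<^sub>v k"
  obtains v c where "v \<in> W" "v \<noteq> 0\<^sub>v k" "A *\<^sub>v v = c \<cdot>\<^sub>v v"
proof -
  obtain as where "char_poly A = (\<Prod>a\<leftarrow>as. [:- a, 1:])"
    using char_poly_factorized[OF A] by blast
  from schur_decomposition_exists[OF A this] obtain U where U: "U \<in> carrier_mat k k"
    "upper_triangular U" "similar_mat A U" by blast
  then obtain P Q where "similar_mat_wit A U P Q"
    unfolding similar_mat_def by blast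
  note PQ = similar_mat_witD2[OF A this]
  have QA: "Q * A = U * Q"
  proof -
    have "Q * A = Q * (P * (U * Q))"
      using PQ by (simp add: assoc_mult_mat[of _ k k _ k _ k])
    also have "\<dots> = (Q * P) * (U * Q)"
      using PQ by (intro assoc_mult_mat[symmetric, of _ k k _ k _ k]) auto
    finally show ?thesis using PQ by simp
  qed
  \<comment> \<open>\<open>Q *\<^sub>v w\<close> is \<open>w\<close> in the triangularising
    coordinates. At \<open>j = k\<close> the support condition is vacuous; at \<open>j = 0\<close>
    it forces \<open>w\<close> to be zero, a contradiction.\<close>
  have "\<exists>v\<in>W. v \<noteq> 0\<^sub>v k \<and> (\<exists>c. A *\<^sub>v v = c \<cdot>\<^sub>v v)"
    if "j \<le> k" "w \<in> W" "w \<noteq> 0\<^sub>v k" "\<forall>i<k. j \<le> i \<longrightarrow> (Q *\<^sub>v w) $ i = 0" for j w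
    using that
  proof (induction j arbitrary: w)
    case 0
    have wk: "w \<in> carrier_vec k" using 0 W by auto
    have "Q *\<^sub>v w = 0\<^sub>v k"
      using 0 PQ by (intro eq_vecI) auto
    then have "P *\<^sub>v (Q *\<^sub>v w) = 0\<^sub>v k"
      using PQ(6) by (intro eq_vecI) auto
    then have "(P * Q) *\<^sub>v w = 0\<^sub>v k"
      using PQ(6,7) wk by (subst assoc_mult_mat_vec[of _ k k _ k])
    then show ?case using PQ wk 0 by simp
  next
    case (Suc j)
    have wk: "w \<in> carrier_vec k" using Suc W by auto
    define d where "d = U $$ (j, j)"
    define u where "u = A *\<^sub>v w - d \<cdot>\<^sub>v w"
    have uW: "u \<in> W" unfolding u_def by (rule inv[OF Suc.prems(2)])
    have Qw: "Q *\<^sub>v w \<in> carrier_vec k" using PQ wk by auto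
    have Qu: "Q *\<^sub>v u = U *\<^sub>v (Q *\<^sub>v w) - d \<cdot>\<^sub>v (Q *\<^sub>v w)"
    proof -
      have "Q *\<^sub>v u = Q *\<^sub>v (A *\<^sub>v w) - Q *\<^sub>v (d \<cdot>\<^sub>v w)"
        unfolding u_def using PQ(7) A wk by (intro mult_minus_distrib_mat_vec) auto
      also have "Q *\<^sub>v (A *\<^sub>v w) = (Q * A) *\<^sub>v w"
        using PQ A wk by (simp add: assoc_mult_mat_vec[of _ k k _ k])
      also have "\<dots> = U *\<^sub>v (Q *\<^sub>v w)"
        unfolding QA using PQ U wk by (simp add: assoc_mult_mat_vec[of _ k k _ k])
      also have "Q *\<^sub>v (d \<cdot>\<^sub>v w) = d \<cdot>\<^sub>v (Q *\<^sub>v w)"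
        using PQ wk by (intro mult_mat_vec) auto
      finally show ?thesis .
    qed
    have "(Q *\<^sub>v u) $ i = 0" if "i < k" "j \<le> i" for i
    proof -
      have "(U *\<^sub>v (Q *\<^sub>v w)) $ i = (\<Sum>l<k. U $$ (i, l) * (Q *\<^sub>v w) $ l)"
        using U that PQ by (auto simp: scalar_prod_def lessThan_atLeast0 intro!: sum.cong)
      \<comment> \<open>Only column \<open>j\<close> survives: for \<open>l < j\<close> the entry of
        \<open>U\<close> lies below the diagonal because \<open>j \<le> i\<close>, and for
        \<open>l > j\<close> the coordinate of \<open>Q *\<^sub>v w\<close> is zero.\<close>
      also have "\<dots> = (\<Sum>l<k. if l = j then U $$ (i, j) * (Q *\<^sub>v w) $ j else 0)"
      proof (rule sum.cong[OF refl])
        fix l assume l: "l \<in> {..<k}"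
        show "U $$ (i, l) * (Q *\<^sub>v w) $ l = (if l = j then U $$ (i, j) * (Q *\<^sub>v w) $ j else 0)"
        proof (cases l j rule: linorder_cases)
          case less
          then show ?thesis using U that by auto
        next
          case greater
          then show ?thesis using Suc.prems(4) l by auto
        qed auto
      qed
      also have "\<dots> = d * (Q *\<^sub>v w) $ i"
      proof (cases "i = j")
        case True
        then show ?thesis using Suc.prems(1) by (simp add: d_def)
      next
        case False
        then show ?thesis using U Suc.prems(1,4) that by auto
      qed
      finally show ?thesis unfolding Qu using Qw carrier_vecD[OF Qw] that by (simp del: dim_mult_mat_vec)
    qed
    \<comment> \<open>Either the descent stops here, with \<open>w\<close> an eigenvector for
      \<open>d\<close>, or \<open>u\<close> is a nonzero member of \<open>W\<close> with smaller
      support and the induction hypothesis applies to it.\<close>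
    moreover have ?case if "u = 0\<^sub>v k"
    proof -
      have "A *\<^sub>v w = d \<cdot>\<^sub>v w"
      proof (rule eq_vecI)
        fix i assume "i < dim_vec (d \<cdot>\<^sub>v w)"
        then have "i < k" using wk by auto
        then have "u $ i = 0" using that by simp
        then show "(A *\<^sub>v w) $ i = (d \<cdot>\<^sub>v w) $ i"
          using \<open>i < k\<close> wk A unfolding u_def by simp
      qed (use wk A in auto)
      then show ?thesis using Suc.prems by blast
    qed
    ultimately show ?case
      using Suc.IH[of u] Suc.prems(1) uW by auto
  qed
  from this[of k w] w that show ?thesis by auto
qed

text \<open>Induction on \<open>F\<close>: the eigenvectors of \<open>B\<close> in \<open>W\<close>
  for one eigenvalue form a set \<open>E\<close> that the remaining matrices preserve, because they
  commute with \<open>B\<close>. Closure under \<open>A *\<^sub>v w - c \<cdot>\<^sub>v w\<close> is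
  all that passes from \<open>W\<close> to \<open>E\<close>, so no subspaces are involved.\<close>

lemma common_eigenvector_in_invariant_set:
  fixes F :: "complex mat set"
  assumes "finite F" "F \<subseteq> carrier_mat k k" "W \<subseteq> carrier_vec k"
    and "\<And>A B. A \<in> F \<Longrightarrow> B \<in> F \<Longrightarrow> A * B = B * A"
    and "\<And>A w c. A \<in> F \<Longrightarrow> w \<in> W \<Longrightarrow> A *\<^sub>v w - c \<cdot>\<^sub>v w \<in> W"
    and "w \<in> W" "w \<noteq> 0\<^sub>v k"
  shows "\<exists>v\<in>W. v \<noteq> 0\<^sub>v k \<and> (\<forall>A\<in>F. \<exists>c. A *\<^sub>v v = c \<cdot>\<^sub>v v)"
  using assms
proof (induction F arbitrary: W w rule: finite_induct)
  case empty
  then show ?case by auto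
next
  case (insert B F)
  have B: "B \<in> carrier_mat k k" using insert.prems by auto
  obtain w' c where w': "w' \<in> W" "w' \<noteq> 0\<^sub>v k" "B *\<^sub>v w' = c \<cdot>\<^sub>v w'"
    using eigenvector_in_invariant_set[OF B insert.prems(2) _ insert.prems(5,6)] insert.prems(4)
    by (metis insertI1)
  define E where "E = {v \<in> W. B *\<^sub>v v = c \<cdot>\<^sub>v v}"
  have E: "A *\<^sub>v v - d \<cdot>\<^sub>v v \<in> E" if "A \<in> F" "v \<in> E" for A v d
  proof -
    have A: "A \<in> carrier_mat k k" using insert.prems(1) that by auto
    have v: "v \<in> W" "v \<in> carrier_vec k" "B *\<^sub>v v = c \<cdot>\<^sub>v v"
      using that insert.prems(2) by (auto simp: E_def)
    have "B *\<^sub>v (A *\<^sub>v v - d \<cdot>\<^sub>v v) = B *\<^sub>v (A *\<^sub>v v) - B *\<^sub>v (d \<cdot>\<^sub>v v)"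
      using A B v by (intro mult_minus_distrib_mat_vec) auto
    also have "B *\<^sub>v (A *\<^sub>v v) = (B * A) *\<^sub>v v"
      using A B v by (simp add: assoc_mult_mat_vec[of _ k k _ k])
    also have "B * A = A * B" using insert.prems(3) that by auto
    also have "(A * B) *\<^sub>v v = A *\<^sub>v (c \<cdot>\<^sub>v v)"
      using A B v by (simp add: assoc_mult_mat_vec[of _ k k _ k])
    also have "\<dots> = c \<cdot>\<^sub>v (A *\<^sub>v v)" using A v by (intro mult_mat_vec) auto
    also have "B *\<^sub>v (d \<cdot>\<^sub>v v) = d \<cdot>\<^sub>v (c \<cdot>\<^sub>v v)"
      using mult_mat_vec[OF B v(2)] v(3) by simp
    also have "c \<cdot>\<^sub>v (A *\<^sub>v v) - d \<cdot>\<^sub>v (c \<cdot>\<^sub>v v) = c \<cdot>\<^sub>v (A *\<^sub>v v - d \<cdot>\<^sub>v v)"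
      using A v by (intro eq_vecI) (auto simp: algebra_simps)
    finally show ?thesis
      using insert.prems(4) that v by (auto simp: E_def)
  qed
  have "\<exists>v\<in>E. v \<noteq> 0\<^sub>v k \<and> (\<forall>A\<in>F. \<exists>c. A *\<^sub>v v = c \<cdot>\<^sub>v v)"
  proof (rule insert.IH)
    show "w' \<in> E" using w' by (simp add: E_def)
  qed (use insert.prems w' E in \<open>auto simp: E_def\<close>)
  then show ?case by (auto simp: E_def)
qed

section \<open>Orthogonal systems\<close>

text \<open>The vectors are nonzero but not normalised, which avoids square roots; the formulas
  below divide by \<open>x \<bullet>c x\<close> instead.\<close>

definition orthogonal_system :: "nat \<Rightarrow> complex vec set \<Rightarrow> bool" where
  "orthogonal_system k X \<longleftrightarrow> X \<subseteq> carrier_vec k \<and> 0\<^sub>v k \<notin> X \<and>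
     (\<forall>x\<in>X. \<forall>y\<in>X. x \<noteq> y \<longrightarrow> x \<bullet>c y = 0)"

text \<open>For a finite orthogonal system \<open>X\<close> this is \<open>u\<close> minus its
  orthogonal projection onto the span of \<open>X\<close>.\<close>

definition residual :: "nat \<Rightarrow> complex vec set \<Rightarrow> complex vec \<Rightarrow> complex vec" where
  "residual k X u = vec k (\<lambda>i. u $ i - (\<Sum>x\<in>X. (u \<bullet>c x) / (x \<bullet>c x) * x $ i))"

lemma residual_carrier [simp]: "residual k X u \<in> carrier_vec k"
  by (simp add: residual_def)

lemma residual_cprod:
  assumes "v \<in> carrier_vec k"
  shows "residual k X u \<bullet>c v = u \<bullet>c v - (\<Sum>x\<in>X. (u \<bullet>c x) / (x \<bullet>c x) * (x \<bullet>c v))"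
proof -
  have "residual k X u \<bullet>c v =
      (\<Sum>i<k. u $ i * cnj (v $ i)) - (\<Sum>i<k. \<Sum>x\<in>X. (u \<bullet>c x) / (x \<bullet>c x) * x $ i * cnj (v $ i))"
    by (simp add: cprod_sum[OF assms] residual_def left_diff_distrib sum_subtractf sum_distrib_right
        del: times_divide_eq_left)
  also have "(\<Sum>i<k. \<Sum>x\<in>X. (u \<bullet>c x) / (x \<bullet>c x) * x $ i * cnj (v $ i))
     = (\<Sum>x\<in>X. (u \<bullet>c x) / (x \<bullet>c x) * (x \<bullet>c v))"
    unfolding cprod_sum[OF assms] by (subst sum.swap) (simp add: sum_distrib_left mult_ac)
  finally show ?thesis by (simp add: cprod_sum[OF assms])
qed

lemma residual_orthogonal:
  assumes "finite X" "orthogonal_system k X" "y \<in> X"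
  shows "residual k X u \<bullet>c y = 0"
proof -
  have y: "y \<in> carrier_vec k" "y \<noteq> 0\<^sub>v k" using assms by (auto simp: orthogonal_system_def)
  have "(\<Sum>x\<in>X. (u \<bullet>c x) / (x \<bullet>c x) * (x \<bullet>c y)) = (\<Sum>x\<in>X. if x = y then u \<bullet>c y else 0)"
    using assms y by (intro sum.cong) (auto simp: orthogonal_system_def)
  then show ?thesis
    using assms(1,3) by (simp add: residual_cprod[OF y(1)])
qed

text \<open>The difference of the two sides is the inner product of the residual with
  \<open>u\<close>. As the residual is orthogonal to \<open>X\<close>, this equals the squared norm
  of the residual.\<close>

lemma bessel:
  assumes "finite X" "orthogonal_system k X" "u \<in> carrier_vec k"
  shows "(\<Sum>x\<in>X. (u \<bullet>c x) * cnj (u \<bullet>c x) / (x \<bullet>c x)) \<le> u \<bullet>c u"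
proof -
  let ?r = "residual k X u"
  have X: "x \<in> carrier_vec k" if "x \<in> X" for x
    using that assms(2) by (auto simp: orthogonal_system_def)
  have "cnj (?r \<bullet>c u) = u \<bullet>c ?r"
    using assms(3) by (intro cprod_commute) auto
  have "?r \<bullet>c ?r = u \<bullet>c ?r - (\<Sum>x\<in>X. (u \<bullet>c x) / (x \<bullet>c x) * (x \<bullet>c ?r))"
    by (rule residual_cprod) simp
  also have "(\<Sum>x\<in>X. (u \<bullet>c x) / (x \<bullet>c x) * (x \<bullet>c ?r)) = 0"
  proof (rule sum.neutral, rule ballI)
    fix x assume x: "x \<in> X"
    have "x \<bullet>c ?r = cnj (?r \<bullet>c x)" using X[OF x] by (intro cprod_commute[symmetric]) auto
    then show "(u \<bullet>c x) / (x \<bullet>c x) * (x \<bullet>c ?r) = 0"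
      by (simp add: residual_orthogonal[OF assms(1,2) x])
  qed
  finally have "?r \<bullet>c u = cnj (?r \<bullet>c ?r)"
    using \<open>cnj (?r \<bullet>c u) = u \<bullet>c ?r\<close> by (metis diff_zero complex_cnj_cnj)
  moreover have "cnj (?r \<bullet>c ?r) = ?r \<bullet>c ?r" by (intro cprod_commute[of _ k]) auto
  ultimately have "0 \<le> ?r \<bullet>c u"
    using conjugate_square_ge_0_vec[of ?r] by simp
  moreover have "?r \<bullet>c u = u \<bullet>c u - (\<Sum>x\<in>X. (u \<bullet>c x) * cnj (u \<bullet>c x) / (x \<bullet>c x))"
    unfolding residual_cprod[OF assms(3)] using X assms(3)
    by (auto intro!: sum.cong simp: cprod_commute)
  ultimately show ?thesis by simp
qed

text \<open>Double counting: each \<open>x\<close> contributes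
  \<open>1 = (x \<bullet>c x) / (x \<bullet>c x)\<close>. Expanded in coordinates and summed over
  \<open>X\<close> first, every coordinate contributes at most \<open>1\<close>, by Bessel's
  inequality for the unit vector.\<close>

lemma orthogonal_system_card_le:
  assumes "finite X" "orthogonal_system k X"
  shows "card X \<le> k"
proof -
  have X: "x \<in> carrier_vec k" "x \<noteq> 0\<^sub>v k" if "x \<in> X" for x
    using that assms(2) by (auto simp: orthogonal_system_def)
  have unit: "unit_vec k i \<bullet>c x = cnj (x $ i)" if "x \<in> carrier_vec k" "i < k" for x :: "complex vec" and i
    using that by simp
  have "of_nat (card X) = (\<Sum>x\<in>X. (x \<bullet>c x) / (x \<bullet>c x))"
    using X by (simp add: conjugate_square_eq_0_vec[of _ k] cong: sum.cong)
  also have "\<dots> = (\<Sum>x\<in>X. \<Sum>i<k. x $ i * cnj (x $ i) / (x \<bullet>c x))"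
    by (rule sum.cong[OF refl]) (simp add: sum_divide_distrib[symmetric] cprod_sum[OF X(1)])
  also have "\<dots> = (\<Sum>i<k. \<Sum>x\<in>X. x $ i * cnj (x $ i) / (x \<bullet>c x))"
    by (rule sum.swap)
  also have "\<dots> \<le> (\<Sum>i<k. 1)"
  proof (rule sum_mono)
    fix i assume i: "i \<in> {..<k}"
    have "(\<Sum>x\<in>X. x $ i * cnj (x $ i) / (x \<bullet>c x)) =
      (\<Sum>x\<in>X. (unit_vec k i \<bullet>c x) * cnj (unit_vec k i \<bullet>c x) / (x \<bullet>c x))"
      using i by (intro sum.cong) (simp_all only: X(1) unit lessThan_iff complex_cnj_cnj mult.commute)
    also have "\<dots> \<le> unit_vec k i \<bullet>c unit_vec k i"
      by (rule bessel[OF assms]) simp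
    also have "\<dots> = 1" using i by (subst unit) auto
    finally show "(\<Sum>x\<in>X. x $ i * cnj (x $ i) / (x \<bullet>c x)) \<le> 1" .
  qed
  finally have "(of_nat (card X) :: complex) \<le> of_nat k" by simp
  then show ?thesis by (simp add: less_eq_complex_def)
qed

text \<open>Completeness annihilates the residual of \<open>u\<close>, since it is orthogonal to all
  of \<open>X\<close>.\<close>

lemma parseval:
  assumes "finite X" "orthogonal_system k X"
    and complete: "\<And>w. w \<in> carrier_vec k \<Longrightarrow> (\<And>x. x \<in> X \<Longrightarrow> w \<bullet>c x = 0) \<Longrightarrow> w = 0\<^sub>v k"
    and "v \<in> carrier_vec k"
  shows "u \<bullet>c v = (\<Sum>x\<in>X. (u \<bullet>c x) * cnj (v \<bullet>c x) / (x \<bullet>c x))"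
proof -
  have "residual k X u = 0\<^sub>v k"
    by (rule complete) (simp_all add: residual_orthogonal[OF assms(1,2)])
  then have "0 = u \<bullet>c v - (\<Sum>x\<in>X. (u \<bullet>c x) / (x \<bullet>c x) * (x \<bullet>c v))"
    using residual_cprod[OF assms(4), of X u] assms(4) by simp
  moreover have "(\<Sum>x\<in>X. (u \<bullet>c x) / (x \<bullet>c x) * (x \<bullet>c v))
      = (\<Sum>x\<in>X. (u \<bullet>c x) * cnj (v \<bullet>c x) / (x \<bullet>c x))"
    using assms(2,4) by (intro sum.cong) (auto simp: cprod_commute orthogonal_system_def)
  ultimately show ?thesis by simp
qed

text \<open>Moving \<open>A\<close> to the other side as an adjoint shows that pairing with
  \<open>x\<close> turns \<open>A\<close> into a scalar. Writing this scalar as a Rayleigh quotient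
  at \<open>x\<close> ties it to the form of \<open>T\<close> on multiples of
  \<open>x\<close>.\<close>

lemma cprod_eigenvector:
  fixes A :: "complex mat"
  assumes A: "A \<in> carrier_mat k k" and u: "u \<in> carrier_vec k"
    and x: "x \<in> carrier_vec k" "x \<noteq> 0\<^sub>v k"
    and eig: "mat_adjoint A *\<^sub>v x = c \<cdot>\<^sub>v x"
  shows "(A *\<^sub>v u) \<bullet>c x = ((A *\<^sub>v x) \<bullet>c x) / (x \<bullet>c x) * (u \<bullet>c x)"
proof -
  have *: "(A *\<^sub>v w) \<bullet>c x = cnj c * (w \<bullet>c x)" if "w \<in> carrier_vec k" for w
    using that x by (simp only: cprod_mat_adjoint[OF A] eig cprod_smult_right)
  show ?thesis using x by (simp add: *[OF u] *[OF x(1)])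
qed

lemma cprod_eigenvector_pow:
  fixes A :: "complex mat"
  assumes A: "A \<in> carrier_mat k k"
    and eig: "\<And>u. u \<in> carrier_vec k \<Longrightarrow> (A *\<^sub>v u) \<bullet>c x = d * (u \<bullet>c x)"
    and u: "u \<in> carrier_vec k"
  shows "(A ^\<^sub>m n *\<^sub>v u) \<bullet>c x = d ^ n * (u \<bullet>c x)"
  using u
proof (induction n arbitrary: u)
  case 0
  then show ?case using A by simp
next
  case (Suc n)
  have "(A ^\<^sub>m Suc n) *\<^sub>v u = A ^\<^sub>m n *\<^sub>v (A *\<^sub>v u)"
    using A Suc.prems by (simp add: assoc_mult_mat_vec[of _ k k _ k])
  then show ?case
    using Suc.IH[of "A *\<^sub>v u"] A Suc.prems by (simp add: eig mult_ac)
qed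

text \<open>A maximal orthogonal system of common eigenvectors is complete: its orthogonal complement
  is invariant, hence if nonzero would contain a further common eigenvector.\<close>
lemma complete_system_of_common_eigenvectors:
  fixes F :: "complex mat set"
  assumes F: "finite F" "F \<subseteq> carrier_mat k k"
    and comm: "\<And>A B. A \<in> F \<Longrightarrow> B \<in> F \<Longrightarrow> A * B = B * A"
    and adj: "\<And>A. A \<in> F \<Longrightarrow> mat_adjoint A \<in> F"
  obtains X where "finite X" "orthogonal_system k X"
    "\<And>x A. x \<in> X \<Longrightarrow> A \<in> F \<Longrightarrow> \<exists>c. A *\<^sub>v x = c \<cdot>\<^sub>v x"
    "\<And>w. w \<in> carrier_vec k \<Longrightarrow> (\<And>x. x \<in> X \<Longrightarrow> w \<bullet>c x = 0) \<Longrightarrow> w = 0\<^sub>v k"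
proof -
  define P where "P = (\<lambda>X. finite X \<and> orthogonal_system k X \<and>
      (\<forall>x\<in>X. \<forall>A\<in>F. \<exists>c. A *\<^sub>v x = c \<cdot>\<^sub>v x))"
  have "P {}" by (simp add: P_def orthogonal_system_def)
  moreover have "card X \<le> k" if "P X" for X
    using that orthogonal_system_card_le by (auto simp: P_def)
  \<comment> \<open>Cardinalities are bounded by \<open>k\<close>, so a system of greatest
    cardinality exists.\<close>
  ultimately obtain X where X: "P X" and max: "\<And>Y. P Y \<Longrightarrow> card Y \<le> card X"
    using ex_has_greatest_nat[of P "{}" card "Suc k"] by (auto simp: less_Suc_eq_le)
  have XP: "finite X" "orthogonal_system k X" "\<And>x A. x \<in> X \<Longrightarrow> A \<in> F \<Longrightarrow> \<exists>c. A *\<^sub>v x = c \<cdot>\<^sub>v x"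
    using X by (auto simp: P_def)
  have Xk: "x \<in> carrier_vec k" "x \<noteq> 0\<^sub>v k" if "x \<in> X" for x
    using that XP(2) by (auto simp: orthogonal_system_def)
  define W where "W = {w \<in> carrier_vec k. \<forall>x\<in>X. w \<bullet>c x = 0}"
  \<comment> \<open>Closure of \<open>F\<close> under adjoints enters here: each \<open>x\<close> in
    \<open>X\<close> is an eigenvector of the adjoint of \<open>A\<close>, so
    \<open>A *\<^sub>v w\<close> stays orthogonal to \<open>x\<close>.\<close>
  have W: "A *\<^sub>v w - c \<cdot>\<^sub>v w \<in> W" if "A \<in> F" "w \<in> W" for A w c
  proof -
    have A: "A \<in> carrier_mat k k" and w: "w \<in> carrier_vec k" using that F by (auto simp: W_def)
    have "(A *\<^sub>v w - c \<cdot>\<^sub>v w) \<bullet>c x = 0" if x: "x \<in> X" for x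
    proof -
      obtain d where "mat_adjoint A *\<^sub>v x = d \<cdot>\<^sub>v x"
        using XP(3)[OF x adj[OF \<open>A \<in> F\<close>]] by blast
      note cprod_eigenvector[OF A w Xk[OF x] this]
      moreover have "w \<bullet>c x = 0" using \<open>w \<in> W\<close> x by (simp add: W_def)
      ultimately show ?thesis
        using A w Xk[OF x] by (simp add: minus_scalar_prod_distrib[of _ k])
    qed
    then show ?thesis using A w by (auto simp: W_def)
  qed
  have "w = 0\<^sub>v k" if "w \<in> carrier_vec k" "\<And>x. x \<in> X \<Longrightarrow> w \<bullet>c x = 0" for w
  proof (rule ccontr)
    assume "w \<noteq> 0\<^sub>v k"
    moreover have "w \<in> W" "W \<subseteq> carrier_vec k" using that by (auto simp: W_def)
    ultimately obtain v where v: "v \<in> W" "v \<noteq> 0\<^sub>v k" "\<forall>A\<in>F. \<exists>c. A *\<^sub>v v = c \<cdot>\<^sub>v v"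
      using common_eigenvector_in_invariant_set[OF F _ comm W] by blast
    have vk: "v \<in> carrier_vec k" using v by (auto simp: W_def)
    have vx: "v \<bullet>c x = 0" if "x \<in> X" for x
      using v that by (auto simp: W_def)
    have xv: "x \<bullet>c v = 0" if "x \<in> X" for x
      using cprod_commute[OF vk Xk(1)[OF that]] vx[OF that] by simp
    have "v \<notin> X" using vx[of v] vk v(2) by auto
    have "P (insert v X)"
      using XP v(2,3) vk vx xv unfolding P_def orthogonal_system_def by auto
    then show False using max[of "insert v X"] \<open>v \<notin> X\<close> XP(1) by simp
  qed
  then show ?thesis using that XP by blast
qed

section \<open>Powers of commuting positive definite functions\<close>

lemma positive_definite_carrier:
  "positive_definite G k T \<Longrightarrow> s \<in> carrier G \<Longrightarrow> T s \<in> carrier_mat k k"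
  unfolding positive_definite_def by blast

lemma positive_definite_inv:
  "positive_definite G k T \<Longrightarrow> s \<in> carrier G \<Longrightarrow> T (inv\<^bsub>G\<^esub> s) = mat_adjoint (T s)"
  unfolding positive_definite_def by blast

text \<open>Positive definiteness is tested on the functions
  \<open>h s = c s \<cdot>\<^sub>v x\<close>. Hermitian symmetry comes from \<open>T\<close> at the
  inverse being the adjoint.\<close>

lemma positive_definite_psd_kernel:
  fixes G :: "('a, 'b) monoid_scheme"
  assumes G: "group G" and T: "positive_definite G k T"
    and S: "finite S" "S \<subseteq> carrier G" and x: "x \<in> carrier_vec k"
  shows "psd_kernel S (\<lambda>s t. (T (inv\<^bsub>G\<^esub> t \<otimes>\<^bsub>G\<^esub> s) *\<^sub>v x) \<bullet>c x)"
proof -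
  interpret group G by (rule G)
  have Tc: "T g \<in> carrier_mat k k" if "g \<in> carrier G" for g
    using that positive_definite_carrier[OF T] by blast
  have Tinv: "T (inv\<^bsub>G\<^esub> g) = mat_adjoint (T g)" if "g \<in> carrier G" for g
    using that positive_definite_inv[OF T] by blast
  have herm: "(T (inv\<^bsub>G\<^esub> t \<otimes>\<^bsub>G\<^esub> s) *\<^sub>v x) \<bullet>c x = cnj ((T (inv\<^bsub>G\<^esub> s \<otimes>\<^bsub>G\<^esub> t) *\<^sub>v x) \<bullet>c x)"
    if "s \<in> S" "t \<in> S" for s t
  proof -
    from that have st: "s \<in> carrier G" "t \<in> carrier G" using S by auto
    then have g: "inv\<^bsub>G\<^esub> s \<otimes>\<^bsub>G\<^esub> t \<in> carrier G" by simp
    have "inv\<^bsub>G\<^esub> t \<otimes>\<^bsub>G\<^esub> s = inv\<^bsub>G\<^esub> (inv\<^bsub>G\<^esub> s \<otimes>\<^bsub>G\<^esub> t)"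
      using st by (simp add: inv_mult_group)
    then have "T (inv\<^bsub>G\<^esub> t \<otimes>\<^bsub>G\<^esub> s) = mat_adjoint (T (inv\<^bsub>G\<^esub> s \<otimes>\<^bsub>G\<^esub> t))"
      using Tinv[OF g] by simp
    moreover have "mat_adjoint (T (inv\<^bsub>G\<^esub> s \<otimes>\<^bsub>G\<^esub> t)) *\<^sub>v x \<in> carrier_vec k"
      using mat_adjoint_carrier[OF Tc[OF g]] x by auto
    ultimately show ?thesis
      using cprod_mat_adjoint[OF Tc[OF g] x x] cprod_commute[OF x] by simp
  qed
  have form: "0 \<le> (\<Sum>s\<in>S. \<Sum>t\<in>S. (T (inv\<^bsub>G\<^esub> t \<otimes>\<^bsub>G\<^esub> s) *\<^sub>v x) \<bullet>c x * (c s * cnj (c t)))" for c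
  proof -
    define h where "h = (\<lambda>s. if s \<in> S then c s \<cdot>\<^sub>v x else 0\<^sub>v k)"
    have h: "h s \<in> carrier_vec k" for s using x by (simp add: h_def)
    \<comment> \<open>The inclusion can be strict, as \<open>c s\<close> or \<open>x\<close> may be
      zero; the missing terms vanish, so the sums extend to \<open>S\<close>.\<close>
    have sub: "supp_on G k h \<subseteq> S" by (auto simp: supp_on_def h_def)
    let ?f = "\<lambda>s t. (T (inv\<^bsub>G\<^esub> t \<otimes>\<^bsub>G\<^esub> s) *\<^sub>v h s) \<bullet>c h t"
    have Tst: "T (inv\<^bsub>G\<^esub> t \<otimes>\<^bsub>G\<^esub> s) \<in> carrier_mat k k" if "s \<in> S" "t \<in> S" for s t
      using that S by (intro Tc) auto
    have z: "?f s t = 0" if "s \<in> S" "t \<in> S" "s \<notin> supp_on G k h \<or> t \<notin> supp_on G k h" for s t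
    proof -
      have "h s = 0\<^sub>v k \<or> h t = 0\<^sub>v k" using that S by (auto simp: supp_on_def)
      then show ?thesis
      proof
        assume "h s = 0\<^sub>v k"
        moreover have "T (inv\<^bsub>G\<^esub> t \<otimes>\<^bsub>G\<^esub> s) *\<^sub>v 0\<^sub>v k = 0\<^sub>v k"
          using Tst[OF that(1,2)] by (intro eq_vecI) auto
        ultimately show ?thesis using h by simp
      next
        assume "h t = 0\<^sub>v k"
        moreover have "T (inv\<^bsub>G\<^esub> t \<otimes>\<^bsub>G\<^esub> s) *\<^sub>v h s \<in> carrier_vec k"
          using Tst[OF that(1,2)] h by auto
        ultimately show ?thesis by simp
      qed
    qed
    have "0 \<le> (\<Sum>s\<in>supp_on G k h. \<Sum>t\<in>supp_on G k h. ?f s t)"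
      using T h finite_subset[OF sub S(1)] by (auto simp: positive_definite_def)
    also have "\<dots> = (\<Sum>s\<in>supp_on G k h. \<Sum>t\<in>S. ?f s t)"
      using S(1) sub z by (intro sum.cong sum.mono_neutral_left) auto
    also have "\<dots> = (\<Sum>s\<in>S. \<Sum>t\<in>S. ?f s t)"
      using S(1) sub z by (intro sum.mono_neutral_left ballI sum.neutral) auto
    also have "\<dots> = (\<Sum>s\<in>S. \<Sum>t\<in>S. (T (inv\<^bsub>G\<^esub> t \<otimes>\<^bsub>G\<^esub> s) *\<^sub>v x) \<bullet>c x * (c s * cnj (c t)))"
    proof (intro sum.cong refl)
      fix s t assume st: "s \<in> S" "t \<in> S"
      have "T (inv\<^bsub>G\<^esub> t \<otimes>\<^bsub>G\<^esub> s) *\<^sub>v (c s \<cdot>\<^sub>v x) = c s \<cdot>\<^sub>v (T (inv\<^bsub>G\<^esub> t \<otimes>\<^bsub>G\<^esub> s) *\<^sub>v x)"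
        by (rule mult_mat_vec[OF Tst[OF st] x])
      moreover have "T (inv\<^bsub>G\<^esub> t \<otimes>\<^bsub>G\<^esub> s) *\<^sub>v x \<in> carrier_vec k"
        using Tst[OF st] x by auto
      ultimately show "?f s t = (T (inv\<^bsub>G\<^esub> t \<otimes>\<^bsub>G\<^esub> s) *\<^sub>v x) \<bullet>c x * (c s * cnj (c t))"
        using st x by (simp add: h_def cprod_smult_right[of _ k])
    qed
    finally show ?thesis .
  qed
  show ?thesis
    unfolding psd_kernel_def using herm form by blast
qed

theorem theorem6p6:
  fixes G :: "('a, 'b) monoid_scheme"
    and k n :: nat
    and T :: "'a \<Rightarrow> complex mat"
  assumes "group G"
    and "positive_definite G k T"
    and "\<And>s t. s \<in> carrier G \<Longrightarrow> t \<in> carrier G \<Longrightarrow> T s * T t = T t * T s"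
  shows "positive_definite G k (\<lambda>s. T s ^\<^sub>m n)"
proof -
  interpret group G by (rule assms(1))
  have Tc: "T g \<in> carrier_mat k k" if "g \<in> carrier G" for g
    using that positive_definite_carrier[OF assms(2)] by blast
  have Tinv: "T (inv\<^bsub>G\<^esub> g) = mat_adjoint (T g)" if "g \<in> carrier G" for g
    using that positive_definite_inv[OF assms(2)] by blast
  have "0 \<le> (\<Sum>s\<in>supp_on G k h. \<Sum>t\<in>supp_on G k h.
      (T (inv\<^bsub>G\<^esub> t \<otimes>\<^bsub>G\<^esub> s) ^\<^sub>m n *\<^sub>v h s) \<bullet>c h t)"
    if h: "h \<in> carrier G \<rightarrow> carrier_vec k" and fin: "finite (supp_on G k h)" for h
  proof -
    define S where "S = supp_on G k h"
    have S: "finite S" "S \<subseteq> carrier G" using fin by (auto simp: S_def supp_on_def)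
    have hc: "h s \<in> carrier_vec k" if "s \<in> S" for s using that S h by auto
    define A where "A = (\<lambda>s t. T (inv\<^bsub>G\<^esub> t \<otimes>\<^bsub>G\<^esub> s))"
    have Ac: "A s t \<in> carrier_mat k k" if "s \<in> S" "t \<in> S" for s t
      unfolding A_def using that S by (intro Tc) auto
    have Aadj: "mat_adjoint (A s t) = A t s" if "s \<in> S" "t \<in> S" for s t
    proof -
      have st: "s \<in> carrier G" "t \<in> carrier G" using that S by auto
      then have "inv\<^bsub>G\<^esub> (inv\<^bsub>G\<^esub> t \<otimes>\<^bsub>G\<^esub> s) = inv\<^bsub>G\<^esub> s \<otimes>\<^bsub>G\<^esub> t"
        by (simp add: inv_mult_group)
      then show ?thesis
        unfolding A_def using st Tinv[of "inv\<^bsub>G\<^esub> t \<otimes>\<^bsub>G\<^esub> s"] by simp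
    qed
    define F where "F = (\<lambda>(s, t). A s t) ` (S \<times> S)"
    have F: "finite F" "F \<subseteq> carrier_mat k k" using S Ac by (auto simp: F_def)
    have comm: "M * N = N * M" if "M \<in> F" "N \<in> F" for M N
      using that S assms(3) by (auto simp: F_def A_def subset_iff)
    have adj: "mat_adjoint M \<in> F" if "M \<in> F" for M
      using that Aadj by (force simp: F_def)
    obtain X where X: "finite X" "orthogonal_system k X"
      and eig: "\<And>x M. x \<in> X \<Longrightarrow> M \<in> F \<Longrightarrow> \<exists>c. M *\<^sub>v x = c \<cdot>\<^sub>v x"
      and complete: "\<And>w. w \<in> carrier_vec k \<Longrightarrow> (\<And>x. x \<in> X \<Longrightarrow> w \<bullet>c x = 0) \<Longrightarrow> w = 0\<^sub>v k"
      using complete_system_of_common_eigenvectors[OF F comm adj] by metis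
    have Xk: "x \<in> carrier_vec k" "x \<noteq> 0\<^sub>v k" if "x \<in> X" for x
      using that X(2) by (auto simp: orthogonal_system_def)
    \<comment> \<open>The eigenvalue is \<open>q x s t / (x \<bullet>c x)\<close>. Keeping the
      numerator separate makes \<open>q x\<close> exactly the kernel shown to be positive
      semidefinite.\<close>
    define q where "q = (\<lambda>x s t. (A s t *\<^sub>v x) \<bullet>c x)"
    have pow: "(A s t ^\<^sub>m n *\<^sub>v u) \<bullet>c x = (q x s t / (x \<bullet>c x)) ^ n * (u \<bullet>c x)"
      if "x \<in> X" "s \<in> S" "t \<in> S" "u \<in> carrier_vec k" for x s t u
    proof (rule cprod_eigenvector_pow[OF Ac[OF that(2,3)] _ that(4)])
      fix v :: "complex vec" assume v: "v \<in> carrier_vec k"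
      have "A t s \<in> F" using that by (auto simp: F_def)
      then have "\<exists>c. mat_adjoint (A s t) *\<^sub>v x = c \<cdot>\<^sub>v x"
        using eig[OF that(1)] Aadj[OF that(2,3)] by metis
      then obtain c where "mat_adjoint (A s t) *\<^sub>v x = c \<cdot>\<^sub>v x" ..
      then show "(A s t *\<^sub>v v) \<bullet>c x = q x s t / (x \<bullet>c x) * (v \<bullet>c x)"
        unfolding q_def by (rule cprod_eigenvector[OF Ac[OF that(2,3)] v Xk[OF that(1)]])
    qed
    \<comment> \<open>In the exponent \<open>Suc n\<close>, \<open>n\<close> factors come from the
      power of the eigenvalue and one from Parseval's identity.\<close>
    have "(\<Sum>s\<in>S. \<Sum>t\<in>S. (A s t ^\<^sub>m n *\<^sub>v h s) \<bullet>c h t)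
      = (\<Sum>s\<in>S. \<Sum>t\<in>S. \<Sum>x\<in>X. (1 / (x \<bullet>c x)) ^ Suc n * (q x s t ^ n * ((h s \<bullet>c x) * cnj (h t \<bullet>c x))))"
    proof (intro sum.cong refl)
      fix s t assume st: "s \<in> S" "t \<in> S"
      have "(A s t ^\<^sub>m n *\<^sub>v h s) \<bullet>c h t
        = (\<Sum>x\<in>X. ((A s t ^\<^sub>m n *\<^sub>v h s) \<bullet>c x) * cnj (h t \<bullet>c x) / (x \<bullet>c x))"
        by (rule parseval[OF X complete hc[OF st(2)]])
      also have "\<dots> = (\<Sum>x\<in>X. (1 / (x \<bullet>c x)) ^ Suc n * (q x s t ^ n * ((h s \<bullet>c x) * cnj (h t \<bullet>c x))))"
        by (rule sum.cong[OF refl]) (simp add: pow[OF _ st hc[OF st(1)]] power_divide mult_ac)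
      finally show "(A s t ^\<^sub>m n *\<^sub>v h s) \<bullet>c h t = \<dots>" .
    qed
    also have "\<dots> = (\<Sum>s\<in>S. \<Sum>x\<in>X. \<Sum>t\<in>S. (1 / (x \<bullet>c x)) ^ Suc n * (q x s t ^ n * ((h s \<bullet>c x) * cnj (h t \<bullet>c x))))"
      by (intro sum.cong refl sum.swap)
    also have "\<dots> = (\<Sum>x\<in>X. (1 / (x \<bullet>c x)) ^ Suc n *
        (\<Sum>s\<in>S. \<Sum>t\<in>S. q x s t ^ n * ((h s \<bullet>c x) * cnj (h t \<bullet>c x))))"
      unfolding sum_distrib_left by (rule sum.swap)
    also have "0 \<le> \<dots>"
    proof (rule sum_nonneg)
      fix x assume x: "x \<in> X"
      have "psd_kernel S (q x)"
        unfolding q_def A_def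
        by (rule positive_definite_psd_kernel[OF assms(1,2) S Xk(1)[OF x]])
      from psd_kernel_form[OF psd_kernel_power[OF S(1) this], of n "\<lambda>s. h s \<bullet>c x"]
      have form: "0 \<le> (\<Sum>s\<in>S. \<Sum>t\<in>S. q x s t ^ n * ((h s \<bullet>c x) * cnj (h t \<bullet>c x)))" .
      have "0 \<le> (1 / (x \<bullet>c x)) ^ Suc n"
        by (intro complex_power_nonneg complex_divide_1_nonneg conjugate_square_ge_0_vec)
      then show "0 \<le> (1 / (x \<bullet>c x)) ^ Suc n *
          (\<Sum>s\<in>S. \<Sum>t\<in>S. q x s t ^ n * ((h s \<bullet>c x) * cnj (h t \<bullet>c x)))"
        using form by (intro mult_nonneg_nonneg)
    qed
    finally show ?thesis unfolding A_def S_def .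
  qed
  \<comment> \<open>The adjoint condition remains: powers commute with taking adjoints.\<close>
  then show ?thesis
    unfolding positive_definite_def using Tc by (simp add: Tinv mat_adjoint_pow[OF Tc])
qed

end
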